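(* The following three conditions on a semigroup $S$ are equivalent. (i) $S$ is a retract ideal extension of a left regular band by a zero semigroup. (ii) $S$ is a subdirect product of a left regular band and a zero semigroup. (iii) $S$ is a left legal semigroup satisfying the identity $ab=a^2b$.
   Context: A semigroup is a nonempty set with an associative multiplication. A semigroup is left legal if it satisfies the identity $aba=ab$. A band is a semigroup in which every element is idempotent ($a^2=a$); a left regular band is a band satisfying the identity $aba=ab$. A zero semigroup is a semigroup containing a zero element $0$ such that $ab=0$ for all elements $a,b$. An ideal of a semigroup $S$ is a nonempty subset $I$ with $sa,as\in I$ for all $a\in I$, $s\in S$. The Rees factor semigroup $S/I$ is the factor of $S$ by the congruence $\{(a,b): a=b \text{ or } a,b\in I\}$. A semigroup $S$ is an ideal extension of a semigroup $B$ by a semigroup $Q$ with zero ($B$ and $Q$ disjoint) if $S$ contains $B$ as an ideal and $S/B$ is isomorphic to $Q$. An ideal $I$ of $S$ is a retract ideal if there is a homomorphism of $S$ onto $I$ which leaves the elements of $I$ fixed. $S$ is a retract ideal extension of $B$ by $Q$ if it is an ideal extension of $B$ by $Q$ and $B$ is a retract ideal of $S$. A semigroup $S$ is a subdirect product of semigroups $S_i$ ($i\in I$) if $S$ is isomorphic to a subsemigroup $T$ of the direct product of the $S_i$ such that the restrictions to $T$ of all the projection homomorphisms are surjective. *)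

theory Defs
  imports "HOL-Algebra.Group"
begin

text \<open>Semigroups are carried by the record type \<^typ>\<open>'a monoid\<close> (and its extensions), so that
  \<^const>\<open>hom\<close>, \<^const>\<open>epi\<close>, \<^const>\<open>is_iso\<close> and \<^const>\<open>DirProd\<close> apply.
  The field \<^const>\<open>one\<close> is never constrained, and need not lie in the carrier;
  none of the library notions used here refers to it in any condition.\<close>

locale carrier_semigroup =
  fixes S (structure)
  assumes nonempty: "carrier S \<noteq> {}"
    and closed: "\<lbrakk>x \<in> carrier S; y \<in> carrier S\<rbrakk> \<Longrightarrow> x \<otimes> y \<in> carrier S"
    and assoc: "\<lbrakk>x \<in> carrier S; y \<in> carrier S; z \<in> carrier S\<rbrakk>
      \<Longrightarrow> (x \<otimes> y) \<otimes> z = x \<otimes> (y \<otimes> z)"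

locale left_legal = carrier_semigroup +
  assumes left_legal: "\<lbrakk>a \<in> carrier S; b \<in> carrier S\<rbrakk> \<Longrightarrow> (a \<otimes> b) \<otimes> a = a \<otimes> b"

locale band = carrier_semigroup +
  assumes idem: "a \<in> carrier S \<Longrightarrow> a \<otimes> a = a"

locale left_regular_band = band +
  assumes left_regular: "\<lbrakk>a \<in> carrier S; b \<in> carrier S\<rbrakk> \<Longrightarrow> (a \<otimes> b) \<otimes> a = a \<otimes> b"

definition is_zero :: "('a, 'm) monoid_scheme \<Rightarrow> 'a \<Rightarrow> bool" where
  "is_zero S z \<longleftrightarrow>
    z \<in> carrier S \<and> (\<forall>a \<in> carrier S. z \<otimes>\<^bsub>S\<^esub> a = z \<and> a \<otimes>\<^bsub>S\<^esub> z = z)"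

definition semigroup_with_zero :: "('a, 'm) monoid_scheme \<Rightarrow> bool" where
  "semigroup_with_zero S \<longleftrightarrow> carrier_semigroup S \<and> (\<exists>z. is_zero S z)"

definition zero_semigroup :: "('a, 'm) monoid_scheme \<Rightarrow> bool" where
  "zero_semigroup S \<longleftrightarrow> carrier_semigroup S \<and>
    (\<exists>z. is_zero S z \<and> (\<forall>a \<in> carrier S. \<forall>b \<in> carrier S. a \<otimes>\<^bsub>S\<^esub> b = z))"

definition semigroup_ideal :: "'a set \<Rightarrow> ('a, 'm) monoid_scheme \<Rightarrow> bool" where
  "semigroup_ideal I S \<longleftrightarrow> I \<noteq> {} \<and> I \<subseteq> carrier S \<and>
    (\<forall>a \<in> I. \<forall>s \<in> carrier S. s \<otimes>\<^bsub>S\<^esub> a \<in> I \<and> a \<otimes>\<^bsub>S\<^esub> s \<in> I)"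

definition subsemigroup :: "'a set \<Rightarrow> ('a, 'm) monoid_scheme \<Rightarrow> bool" where
  "subsemigroup T S \<longleftrightarrow> T \<noteq> {} \<and> T \<subseteq> carrier S \<and>
    (\<forall>x \<in> T. \<forall>y \<in> T. x \<otimes>\<^bsub>S\<^esub> y \<in> T)"

definition rees_congruence :: "('a, 'm) monoid_scheme \<Rightarrow> 'a set \<Rightarrow> 'a rel" where
  "rees_congruence S I =
    {(a, b). a \<in> carrier S \<and> b \<in> carrier S \<and> (a = b \<or> a \<in> I \<and> b \<in> I)}"

text \<open>The product of two congruence classes is the class of the product of representatives;
  when the set is an ideal, all members of the union below coincide.\<close>

definition rees_factor :: "('a, 'm) monoid_scheme \<Rightarrow> 'a set \<Rightarrow> 'a set monoid" where
  "rees_factor S I =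
    \<lparr>carrier = carrier S // rees_congruence S I,
     mult = (\<lambda>X Y. \<Union>x \<in> X. \<Union>y \<in> Y. rees_congruence S I `` {x \<otimes>\<^bsub>S\<^esub> y}),
     one = rees_congruence S I `` {\<one>\<^bsub>S\<^esub>}\<rparr>"

text \<open>The semigroup \<open>B\<close> is literally contained in \<open>S\<close>, hence has the same element type,
  whereas \<open>Q\<close>, which matters only up to isomorphism, has an element type of its own.
  This plays the role of the usual convention that \<open>B\<close> and \<open>Q\<close> are disjoint.\<close>

definition ideal_extension ::
  "('a, 'm) monoid_scheme \<Rightarrow> ('a, 'n) monoid_scheme \<Rightarrow> ('q, 'k) monoid_scheme \<Rightarrow> bool" where
  "ideal_extension S B Q \<longleftrightarrow>
    carrier_semigroup S \<and> carrier_semigroup B \<and> semigroup_with_zero Q \<and>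
    semigroup_ideal (carrier B) S \<and>
    (\<forall>x \<in> carrier B. \<forall>y \<in> carrier B. x \<otimes>\<^bsub>B\<^esub> y = x \<otimes>\<^bsub>S\<^esub> y) \<and>
    rees_factor S (carrier B) \<cong> Q"

definition retract_ideal :: "'a set \<Rightarrow> ('a, 'm) monoid_scheme \<Rightarrow> bool" where
  "retract_ideal I S \<longleftrightarrow> semigroup_ideal I S \<and>
    (\<exists>r \<in> epi S (S\<lparr>carrier := I\<rparr>). \<forall>x \<in> I. r x = x)"

definition retract_ideal_extension ::
  "('a, 'm) monoid_scheme \<Rightarrow> ('a, 'n) monoid_scheme \<Rightarrow> ('q, 'k) monoid_scheme \<Rightarrow> bool" where
  "retract_ideal_extension S B Q \<longleftrightarrow> ideal_extension S B Q \<and> retract_ideal (carrier B) S"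

definition subdirect_product ::
  "('a, 'm) monoid_scheme \<Rightarrow> ('b, 'n) monoid_scheme \<Rightarrow> ('c, 'k) monoid_scheme \<Rightarrow> bool" where
  "subdirect_product S S1 S2 \<longleftrightarrow>
    carrier_semigroup S \<and> carrier_semigroup S1 \<and> carrier_semigroup S2 \<and>
    (\<exists>T. subsemigroup T (S1 \<times>\<times> S2) \<and> S \<cong> (S1 \<times>\<times> S2)\<lparr>carrier := T\<rparr> \<and>
      fst ` T = carrier S1 \<and> snd ` T = carrier S2)"

end

theory Submission
  imports Defs
begin

text \<open>
  A retraction \<open>r\<close> onto \<open>B \<supseteq> S\<^sup>2\<close> gives \<open>x y = r(x) r(y)\<close>, so every identity of \<open>B\<close> between
  products of length at least two holds in \<open>S\<close>. Conversely, under (iii) we have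
  \<open>a b a b = a (b a b) = a b a = a b\<close>, so \<open>S\<^sup>2\<close> is a left regular band and an ideal with zero factor
  semigroup. The squaring map is a retraction onto it, because
  \<open>a\<^sup>2 b\<^sup>2 = a b b = a b a b = a b = (a b)\<^sup>2\<close>, and together with the projection onto the Rees factor
  it separates points.
\<close>

section \<open>Rees classes and multiplication in the Rees factor\<close>

lemma rees_class_eq_iff:
  assumes "x \<in> carrier S" "y \<in> carrier S"
  shows "rees_congruence S I `` {x} = rees_congruence S I `` {y} \<longleftrightarrow> x = y \<or> x \<in> I \<and> y \<in> I"
  using assms by (auto simp: rees_congruence_def)

lemma carrier_rees_factor:
  "carrier (rees_factor S I) = (\<lambda>x. rees_congruence S I `` {x}) ` carrier S"
  by (auto simp: rees_factor_def quotient_def)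

text \<open>Exchanging a factor for a congruent one either leaves the product unchanged or keeps
  both products in \<open>I\<close>, because \<open>I\<close> absorbs on both sides. Hence all
  members of the defining union are the same class.\<close>

lemma rees_factor_mult:
  assumes S: "carrier_semigroup S" and I: "semigroup_ideal I S"
    and x: "x \<in> carrier S" and y: "y \<in> carrier S"
  shows "rees_congruence S I `` {x} \<otimes>\<^bsub>rees_factor S I\<^esub> rees_congruence S I `` {y} =
    rees_congruence S I `` {x \<otimes>\<^bsub>S\<^esub> y}"
proof -
  let ?R = "rees_congruence S I"
  have "?R `` {u \<otimes>\<^bsub>S\<^esub> v} = ?R `` {x \<otimes>\<^bsub>S\<^esub> y}" if "u \<in> ?R `` {x}" "v \<in> ?R `` {y}" for u v
  proof -
    from that have uv: "u \<in> carrier S" "v \<in> carrier S"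
      and "u = x \<or> u \<in> I \<and> x \<in> I" "v = y \<or> v \<in> I \<and> y \<in> I"
      by (auto simp: rees_congruence_def)
    then have "u \<otimes>\<^bsub>S\<^esub> v = x \<otimes>\<^bsub>S\<^esub> y \<or> u \<otimes>\<^bsub>S\<^esub> v \<in> I \<and> x \<otimes>\<^bsub>S\<^esub> y \<in> I"
      using I x y unfolding semigroup_ideal_def by metis
    then show ?thesis
      using carrier_semigroup.closed[OF S] uv x y by (simp add: rees_class_eq_iff)
  qed
  then have "(\<Union>u \<in> ?R `` {x}. \<Union>v \<in> ?R `` {y}. ?R `` {u \<otimes>\<^bsub>S\<^esub> v}) =
      (\<Union>u \<in> ?R `` {x}. \<Union>v \<in> ?R `` {y}. ?R `` {x \<otimes>\<^bsub>S\<^esub> y})"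
    by (intro SUP_cong refl)
  \<comment> \<open>Each class contains its representative; a union over an empty index set would be
    \<open>{}\<close> instead of the common value.\<close>
  moreover have "x \<in> ?R `` {x}" "y \<in> ?R `` {y}"
    using x y by (auto simp: rees_congruence_def)
  then have "?R `` {x} \<noteq> {}" "?R `` {y} \<noteq> {}"
    by blast+
  ultimately show ?thesis
    by (simp add: rees_factor_def del: Image_singleton_iff)
qed

text \<open>Since all products fall into \<open>I\<close>, their classes coincide with the class of
  any \<open>i\<close> in \<open>I\<close>. This class is the zero, and associativity holds because
  both sides equal it.\<close>

lemma zero_semigroup_rees_factor:
  assumes S: "carrier_semigroup S" and I: "semigroup_ideal I S"
    and prod: "\<And>x y. \<lbrakk>x \<in> carrier S; y \<in> carrier S\<rbrakk> \<Longrightarrow> x \<otimes>\<^bsub>S\<^esub> y \<in> I"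
  shows "zero_semigroup (rees_factor S I)"
proof -
  let ?cl = "\<lambda>x. rees_congruence S I `` {x}" and ?Q = "rees_factor S I"
  obtain i where i: "i \<in> I" and IS: "I \<subseteq> carrier S"
    using I by (auto simp: semigroup_ideal_def)
  have iS: "?cl i \<in> carrier ?Q"
    using i IS by (auto simp: carrier_rees_factor)
  have mult: "X \<otimes>\<^bsub>?Q\<^esub> Y = ?cl i" if "X \<in> carrier ?Q" "Y \<in> carrier ?Q" for X Y
  proof -
    from that obtain x y where xy: "x \<in> carrier S" "y \<in> carrier S" "X = ?cl x" "Y = ?cl y"
      by (auto simp: carrier_rees_factor)
    have "?cl (x \<otimes>\<^bsub>S\<^esub> y) = ?cl i"
      using xy(1,2) prod i IS by (subst rees_class_eq_iff) auto
    then show ?thesis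
      using xy by (simp add: rees_factor_mult[OF S I])
  qed
  then have "carrier_semigroup ?Q"
    using iS by unfold_locales auto
  then show ?thesis
    unfolding zero_semigroup_def is_zero_def using mult iS by blast
qed

text \<open>All products in \<open>Q\<close> agree, so injectivity of the isomorphism puts all
  products of \<open>S\<close> into a single Rees class. Comparison with a product
  \<open>i \<otimes> i\<close> of elements of \<open>B\<close>, which certainly lies in
  \<open>B\<close>, identifies that class.\<close>

lemma ideal_extension_by_zero_semigroup_mult_mem:
  assumes ext: "ideal_extension S B Q" and Q: "zero_semigroup Q"
    and x: "x \<in> carrier S" and y: "y \<in> carrier S"
  shows "x \<otimes>\<^bsub>S\<^esub> y \<in> carrier B"
proof -
  let ?I = "carrier B"
  let ?cl = "\<lambda>x. rees_congruence S ?I `` {x}" and ?F = "rees_factor S ?I"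
  from ext have S: "carrier_semigroup S" and I: "semigroup_ideal ?I S" and iso: "?F \<cong> Q"
    by (auto simp: ideal_extension_def)
  from iso obtain f where hom: "f \<in> hom ?F Q" and inj: "inj_on f (carrier ?F)"
    by (auto simp: is_iso_def iso_def bij_betw_def)
  from Q obtain z where z: "\<And>a b. \<lbrakk>a \<in> carrier Q; b \<in> carrier Q\<rbrakk> \<Longrightarrow> a \<otimes>\<^bsub>Q\<^esub> b = z"
    by (auto simp: zero_semigroup_def)
  have cl: "?cl u \<in> carrier ?F" if "u \<in> carrier S" for u
    using that by (auto simp: carrier_rees_factor)
  have fz: "f (?cl (u \<otimes>\<^bsub>S\<^esub> v)) = z" if "u \<in> carrier S" "v \<in> carrier S" for u v
    using hom_mult[OF hom cl cl] z hom_in_carrier[OF hom cl] that rees_factor_mult[OF S I] by metis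
  obtain i where i: "i \<in> ?I" "i \<in> carrier S" "i \<otimes>\<^bsub>S\<^esub> i \<in> ?I"
    using I by (auto simp: semigroup_ideal_def)
  note closed = carrier_semigroup.closed[OF S]
  have "?cl (x \<otimes>\<^bsub>S\<^esub> y) = ?cl (i \<otimes>\<^bsub>S\<^esub> i)"
    using inj_onD[OF inj _ cl cl] fz closed x y i by metis
  then show ?thesis
    using i closed x y by (auto simp: rees_class_eq_iff)
qed

section \<open>From the structural conditions to the identities\<close>

lemma retract_ideal_extension_imp_left_legal:
  assumes B: "left_regular_band B" and Q: "zero_semigroup Q" and ext: "retract_ideal_extension S B Q"
  shows "left_legal S \<and>
    (\<forall>a \<in> carrier S. \<forall>b \<in> carrier S. a \<otimes>\<^bsub>S\<^esub> b = (a \<otimes>\<^bsub>S\<^esub> a) \<otimes>\<^bsub>S\<^esub> b)"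
proof -
  interpret B: left_regular_band B by fact
  from ext have ie: "ideal_extension S B Q" and ri: "retract_ideal (carrier B) S"
    by (auto simp: retract_ideal_extension_def)
  interpret S: carrier_semigroup S
    using ie by (simp add: ideal_extension_def)
  have BS: "x \<otimes>\<^bsub>S\<^esub> y = x \<otimes>\<^bsub>B\<^esub> y" if "x \<in> carrier B" "y \<in> carrier B" for x y
    using ie that by (simp add: ideal_extension_def)
  have B_subset: "x \<in> carrier S" if "x \<in> carrier B" for x
    using ie that by (auto simp: ideal_extension_def semigroup_ideal_def)
  from ri obtain r where hom: "r \<in> hom S (S\<lparr>carrier := carrier B\<rparr>)"
    and fix_r: "\<And>x. x \<in> carrier B \<Longrightarrow> r x = x"
    by (auto simp: retract_ideal_def epi_def)
  have r: "r x \<in> carrier B" if "x \<in> carrier S" for x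
    using hom_in_carrier[OF hom that] by simp
  have prod: "x \<otimes>\<^bsub>S\<^esub> y = r x \<otimes>\<^bsub>B\<^esub> r y" if xy: "x \<in> carrier S" "y \<in> carrier S" for x y
  proof -
    have "x \<otimes>\<^bsub>S\<^esub> y = r (x \<otimes>\<^bsub>S\<^esub> y)"
      using fix_r ideal_extension_by_zero_semigroup_mult_mem[OF ie Q xy] by simp
    also have "\<dots> = r x \<otimes>\<^bsub>S\<^esub> r y"
      using hom_mult[OF hom xy] by simp
    finally show ?thesis
      using BS r xy by simp
  qed
  show ?thesis
  proof (intro conjI ballI)
    show "left_legal S"
      \<comment> \<open>After \<open>prod\<close> rewrites an inner product it is an element of
        \<open>B\<close>; \<open>B_subset\<close> lets \<open>prod\<close> apply again to the outer
        product, and \<open>fix_r\<close> removes the \<open>r\<close> this puts around the inner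
        one. What remains is left regularity in \<open>B\<close>.\<close>
      by unfold_locales (simp add: prod B_subset r fix_r B.closed B.left_regular)
  next
    fix a b assume "a \<in> carrier S" "b \<in> carrier S"
    then show "a \<otimes>\<^bsub>S\<^esub> b = (a \<otimes>\<^bsub>S\<^esub> a) \<otimes>\<^bsub>S\<^esub> b"
      by (simp add: prod B_subset r fix_r B.closed B.idem)
  qed
qed

text \<open>Both identities hold in \<open>B\<close>, and in \<open>Z\<close> they hold because both
  sides are products and hence equal \<open>z\<close>. The injective homomorphism \<open>f\<close>
  carries them back from the direct product to \<open>S\<close>.\<close>

lemma subdirect_product_imp_left_legal:
  assumes B: "left_regular_band B" and Z: "zero_semigroup Z" and sub: "subdirect_product S B Z"
  shows "left_legal S \<and>
    (\<forall>a \<in> carrier S. \<forall>b \<in> carrier S. a \<otimes>\<^bsub>S\<^esub> b = (a \<otimes>\<^bsub>S\<^esub> a) \<otimes>\<^bsub>S\<^esub> b)"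
proof -
  interpret B: left_regular_band B by fact
  interpret S: carrier_semigroup S
    using sub by (simp add: subdirect_product_def)
  interpret Z: carrier_semigroup Z
    using Z by (simp add: zero_semigroup_def)
  from Z obtain z where z: "\<And>a b. \<lbrakk>a \<in> carrier Z; b \<in> carrier Z\<rbrakk> \<Longrightarrow> a \<otimes>\<^bsub>Z\<^esub> b = z"
    and zZ: "z \<in> carrier Z"
    by (auto simp: zero_semigroup_def is_zero_def)
  from sub obtain T f where T: "T \<subseteq> carrier (B \<times>\<times> Z)"
    and hom: "f \<in> hom S ((B \<times>\<times> Z)\<lparr>carrier := T\<rparr>)" and inj: "inj_on f (carrier S)"
    by (auto simp: subdirect_product_def subsemigroup_def is_iso_def iso_def bij_betw_def)
  have f: "fst (f x) \<in> carrier B \<and> snd (f x) \<in> carrier Z" if "x \<in> carrier S" for x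
    using hom_in_carrier[OF hom that] T by (auto simp: DirProd_def)
  have mult: "f (x \<otimes>\<^bsub>S\<^esub> y) = (fst (f x) \<otimes>\<^bsub>B\<^esub> fst (f y), snd (f x) \<otimes>\<^bsub>Z\<^esub> snd (f y))"
    if "x \<in> carrier S" "y \<in> carrier S" for x y
    using hom_mult[OF hom that] by (simp add: DirProd_def case_prod_beta)
  show ?thesis
  proof (intro conjI ballI)
    show "left_legal S"
    proof unfold_locales
      fix a b assume ab: "a \<in> carrier S" "b \<in> carrier S"
      then have "f ((a \<otimes>\<^bsub>S\<^esub> b) \<otimes>\<^bsub>S\<^esub> a) = f (a \<otimes>\<^bsub>S\<^esub> b)"
        using f[OF ab(1)] f[OF ab(2)] by (simp add: mult S.closed B.left_regular z zZ)
      then show "(a \<otimes>\<^bsub>S\<^esub> b) \<otimes>\<^bsub>S\<^esub> a = a \<otimes>\<^bsub>S\<^esub> b"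
        using inj_onD[OF inj] ab S.closed by simp
    qed
  next
    fix a b assume ab: "a \<in> carrier S" "b \<in> carrier S"
    then have "f (a \<otimes>\<^bsub>S\<^esub> b) = f ((a \<otimes>\<^bsub>S\<^esub> a) \<otimes>\<^bsub>S\<^esub> b)"
      using f[OF ab(1)] f[OF ab(2)] by (simp add: mult S.closed B.idem z zZ)
    then show "a \<otimes>\<^bsub>S\<^esub> b = (a \<otimes>\<^bsub>S\<^esub> a) \<otimes>\<^bsub>S\<^esub> b"
      using inj_onD[OF inj] ab S.closed by simp
  qed
qed

section \<open>The set of products of a left legal semigroup\<close>

context left_legal
begin

text \<open>This is the ideal of all products, made a semigroup on the same element type so that it
  is literally contained in \<open>S\<close>. It is a plain \<open>monoid\<close> record even if
  \<open>S\<close> has further fields, and its \<open>one\<close> is arbitrary.\<close>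

definition square_part :: "'a monoid" where
  "square_part =
    \<lparr>carrier = {a \<otimes> b |a b. a \<in> carrier S \<and> b \<in> carrier S}, mult = (\<otimes>), one = undefined\<rparr>"

lemma mult_mem_square_part:
  "\<lbrakk>a \<in> carrier S; b \<in> carrier S\<rbrakk> \<Longrightarrow> a \<otimes> b \<in> carrier square_part"
  by (auto simp: square_part_def)

lemma mult_square_part [simp]: "x \<otimes>\<^bsub>square_part\<^esub> y = x \<otimes> y"
  by (simp add: square_part_def)

lemma square_part_subset: "x \<in> carrier square_part \<Longrightarrow> x \<in> carrier S"
  by (auto simp: square_part_def closed)

lemma mult_idem:
  assumes "a \<in> carrier S" "b \<in> carrier S"
  shows "(a \<otimes> b) \<otimes> (a \<otimes> b) = a \<otimes> b"
proof -
  have "(a \<otimes> b) \<otimes> (a \<otimes> b) = a \<otimes> ((b \<otimes> a) \<otimes> b)"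
    using assms by (simp add: assoc closed)
  also have "\<dots> = (a \<otimes> b) \<otimes> a"
    using assms by (simp add: left_legal[of b a] assoc[of a b a])
  finally show ?thesis
    using assms by (simp add: left_legal)
qed

lemma square_part_idem: "x \<in> carrier square_part \<Longrightarrow> x \<otimes> x = x"
  by (auto simp: square_part_def mult_idem)

lemma square_image: "(\<lambda>x. x \<otimes> x) ` carrier S = carrier square_part"
proof
  show "carrier square_part \<subseteq> (\<lambda>x. x \<otimes> x) ` carrier S"
    \<comment> \<open>A product is its own square, hence its own preimage under squaring.\<close>
    using square_part_idem[symmetric] square_part_subset by (intro subsetI image_eqI)
qed (auto simp: mult_mem_square_part)

lemma mult_right_absorb:
  assumes "a \<in> carrier S" "b \<in> carrier S"
  shows "(a \<otimes> b) \<otimes> b = a \<otimes> b"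
proof -
  \<comment> \<open>Left legality is read backwards: the extra \<open>a\<close> creates a second
    copy of \<open>a \<otimes> b\<close>.\<close>
  have "(a \<otimes> b) \<otimes> b = ((a \<otimes> b) \<otimes> a) \<otimes> b"
    using assms by (simp add: left_legal)
  also have "\<dots> = (a \<otimes> b) \<otimes> (a \<otimes> b)"
    using assms by (simp add: assoc closed)
  finally show ?thesis
    using assms by (simp add: mult_idem)
qed

lemma semigroup_ideal_square_part: "semigroup_ideal (carrier square_part) S"
  using nonempty mult_mem_square_part square_part_subset
  by (auto simp: semigroup_ideal_def)

lemma left_regular_band_square_part: "left_regular_band square_part"
proof unfold_locales
  show "carrier square_part \<noteq> {}"
    using semigroup_ideal_square_part by (simp add: semigroup_ideal_def)
\<comment> \<open>Rewriting with \<open>assoc\<close> leaves left regularity bracketed to the right;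
  the second call restores the bracketing that \<open>left_legal\<close> expects.\<close>
qed (simp_all add: mult_mem_square_part square_part_subset assoc square_part_idem,
  simp add: assoc[symmetric] left_legal square_part_subset)

lemma zero_semigroup_square_part: "zero_semigroup (rees_factor S (carrier square_part))"
  using zero_semigroup_rees_factor carrier_semigroup_axioms semigroup_ideal_square_part
    mult_mem_square_part by blast

lemma ideal_extension_square_part:
  "ideal_extension S square_part (rees_factor S (carrier square_part))"
  using left_regular_band_square_part zero_semigroup_square_part
  by (auto simp: ideal_extension_def semigroup_with_zero_def zero_semigroup_def iso_refl
      carrier_semigroup_axioms semigroup_ideal_square_part left_regular_band_def band_def)

section \<open>Consequences of the additional identity\<close>

context
  assumes square_left: "\<And>a b. \<lbrakk>a \<in> carrier S; b \<in> carrier S\<rbrakk> \<Longrightarrow> a \<otimes> b = (a \<otimes> a) \<otimes> b"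
begin

lemma square_mult:
  assumes "a \<in> carrier S" "b \<in> carrier S"
  shows "(a \<otimes> b) \<otimes> (a \<otimes> b) = (a \<otimes> a) \<otimes> (b \<otimes> b)"
proof -
  \<comment> \<open>The identity is read from right to left with \<open>b \<otimes> b\<close> as its
    second factor.\<close>
  have "(a \<otimes> a) \<otimes> (b \<otimes> b) = (a \<otimes> b) \<otimes> b"
    using assms square_left[of a "b \<otimes> b", symmetric] by (simp add: assoc closed)
  then show ?thesis
    using assms by (simp add: mult_right_absorb mult_idem)
qed

lemma retract_ideal_square_part: "retract_ideal (carrier square_part) S"
proof -
  let ?r = "\<lambda>x. x \<otimes> x"
  have "?r \<in> epi S (S\<lparr>carrier := carrier square_part\<rparr>)"
    using square_image by (auto simp: epi_def hom_def square_mult mult_mem_square_part)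
  then show ?thesis
    unfolding retract_ideal_def using semigroup_ideal_square_part square_part_idem
    by (intro conjI bexI[of _ ?r]) simp_all
qed

lemma subdirect_product_square_part:
  "subdirect_product S square_part (rees_factor S (carrier square_part))"
proof -
  let ?B = "square_part" and ?Q = "rees_factor S (carrier square_part)"
  let ?cl = "\<lambda>x. rees_congruence S (carrier ?B) `` {x}"
  define f where "f = (\<lambda>x. (x \<otimes> x, ?cl x))"
  \<comment> \<open>With the image itself as \<open>?T\<close>, \<open>f\<close> is onto by
    construction, and closure follows from the homomorphism law \<open>mult\<close>.\<close>
  let ?T = "f ` carrier S"
  have mult: "f (x \<otimes> y) = f x \<otimes>\<^bsub>?B \<times>\<times> ?Q\<^esub> f y" if "x \<in> carrier S" "y \<in> carrier S" for x y
    using that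
    by (simp add: f_def square_mult
        rees_factor_mult[OF carrier_semigroup_axioms semigroup_ideal_square_part])
  have inj: "inj_on f (carrier S)"
    \<comment> \<open>Elements with equal classes are equal or both products; in the latter case
      each is its own square, so equal squares give equality.\<close>
    by (rule inj_onI) (auto simp: f_def rees_class_eq_iff square_part_idem)
  have sub: "subsemigroup ?T (?B \<times>\<times> ?Q)"
    unfolding subsemigroup_def
  proof (intro conjI)
    show "?T \<subseteq> carrier (?B \<times>\<times> ?Q)"
      by (auto simp: f_def DirProd_def carrier_rees_factor mult_mem_square_part)
    show "\<forall>x \<in> ?T. \<forall>y \<in> ?T. x \<otimes>\<^bsub>?B \<times>\<times> ?Q\<^esub> y \<in> ?T"
      using closed by (auto simp: mult[symmetric])
  qed (use nonempty in simp)
  have "f \<in> iso S ((?B \<times>\<times> ?Q)\<lparr>carrier := ?T\<rparr>)"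
    using inj mult by (auto simp: iso_def hom_def bij_betw_def)
  then have iso: "S \<cong> (?B \<times>\<times> ?Q)\<lparr>carrier := ?T\<rparr>"
    by (auto simp: is_iso_def)
  have fst: "fst ` ?T = carrier ?B"
    by (simp add: f_def image_image square_image)
  have snd: "snd ` ?T = carrier ?Q"
    by (auto simp: f_def carrier_rees_factor image_iff)
  have "carrier_semigroup ?B" "carrier_semigroup ?Q"
    using ideal_extension_square_part
    by (auto simp: ideal_extension_def semigroup_with_zero_def zero_semigroup_square_part[unfolded zero_semigroup_def])
  then show ?thesis
    unfolding subdirect_product_def using carrier_semigroup_axioms sub iso fst snd by blast
qed

end

end

text \<open>A HOL existential fixes the types of its witnesses. The types \<open>'a\<close> and
  \<open>'a set\<close> accommodate \<open>square_part\<close> and its Rees factor; the last two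
  conjuncts give the implications to the identities for witnesses over arbitrary types.\<close>

theorem theorem4:
  fixes S :: "('a, 'm) monoid_scheme"
  assumes "carrier_semigroup S"
  shows
    "((\<exists>(B :: 'a monoid) (Q :: 'a set monoid).
         left_regular_band B \<and> zero_semigroup Q \<and> retract_ideal_extension S B Q)
      \<longleftrightarrow>
      (\<exists>(B :: 'a monoid) (Z :: 'a set monoid).
         left_regular_band B \<and> zero_semigroup Z \<and> subdirect_product S B Z))
     \<and>
     ((\<exists>(B :: 'a monoid) (Z :: 'a set monoid).
         left_regular_band B \<and> zero_semigroup Z \<and> subdirect_product S B Z)
      \<longleftrightarrow>
      (left_legal S \<and>
       (\<forall>a \<in> carrier S. \<forall>b \<in> carrier S. a \<otimes>\<^bsub>S\<^esub> b = (a \<otimes>\<^bsub>S\<^esub> a) \<otimes>\<^bsub>S\<^esub> b)))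
     \<and>
     ((\<exists>(B :: 'a monoid) (Q :: 'q monoid).
         left_regular_band B \<and> zero_semigroup Q \<and> retract_ideal_extension S B Q)
      \<longrightarrow>
      (left_legal S \<and>
       (\<forall>a \<in> carrier S. \<forall>b \<in> carrier S. a \<otimes>\<^bsub>S\<^esub> b = (a \<otimes>\<^bsub>S\<^esub> a) \<otimes>\<^bsub>S\<^esub> b)))
     \<and>
     ((\<exists>(B :: 'b monoid) (Z :: 'c monoid).
         left_regular_band B \<and> zero_semigroup Z \<and> subdirect_product S B Z)
      \<longrightarrow>
      (left_legal S \<and>
       (\<forall>a \<in> carrier S. \<forall>b \<in> carrier S. a \<otimes>\<^bsub>S\<^esub> b = (a \<otimes>\<^bsub>S\<^esub> a) \<otimes>\<^bsub>S\<^esub> b)))"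
proof -
  let ?legal = "left_legal S \<and>
    (\<forall>a \<in> carrier S. \<forall>b \<in> carrier S. a \<otimes>\<^bsub>S\<^esub> b = (a \<otimes>\<^bsub>S\<^esub> a) \<otimes>\<^bsub>S\<^esub> b)"
  let ?ext = "\<exists>(B :: 'a monoid) (Q :: 'a set monoid).
      left_regular_band B \<and> zero_semigroup Q \<and> retract_ideal_extension S B Q"
  let ?sub = "\<exists>(B :: 'a monoid) (Z :: 'a set monoid).
      left_regular_band B \<and> zero_semigroup Z \<and> subdirect_product S B Z"
  \<comment> \<open>The same two witnesses serve both structural conditions.\<close>
  have legal_imp: "?ext \<and> ?sub" if legal: ?legal
  proof -
    interpret left_legal S using legal by simp
    have sq: "a \<otimes>\<^bsub>S\<^esub> b = (a \<otimes>\<^bsub>S\<^esub> a) \<otimes>\<^bsub>S\<^esub> b" if "a \<in> carrier S" "b \<in> carrier S" for a b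
      by (rule legal[THEN conjunct2, rule_format, OF that])
    have "retract_ideal_extension S square_part (rees_factor S (carrier square_part))"
      unfolding retract_ideal_extension_def
      by (intro conjI ideal_extension_square_part retract_ideal_square_part sq)
    moreover have "subdirect_product S square_part (rees_factor S (carrier square_part))"
      by (intro subdirect_product_square_part sq)
    ultimately show ?thesis
      using left_regular_band_square_part zero_semigroup_square_part by blast
  qed
  have ext_imp: "?ext \<Longrightarrow> ?legal"
    by (elim exE conjE) (rule retract_ideal_extension_imp_left_legal)
  have sub_imp: "?sub \<Longrightarrow> ?legal"
    by (elim exE conjE) (rule subdirect_product_imp_left_legal)
  show ?thesis
  proof (rule conjI[OF _ conjI[OF _ conjI]])
    show "?ext \<longleftrightarrow> ?sub"
      using ext_imp sub_imp legal_imp by argo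
    show "?sub \<longleftrightarrow> ?legal"
      using sub_imp legal_imp by argo
  \<comment> \<open>\<open>ext_imp\<close> and \<open>sub_imp\<close> are tied to the witness types
    \<open>'a\<close> and \<open>'a set\<close>, so the conjuncts over \<open>'q\<close>,
    \<open>'b\<close> and \<open>'c\<close> go back to the polymorphic lemmas.\<close>
  qed (rule impI, elim exE conjE,
      rule retract_ideal_extension_imp_left_legal subdirect_product_imp_left_legal, assumption+)+
qed

end
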